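(* Let $M$ and $N$ be two monoids, let $A$ be a finitely presented $M$-act, and let $B$ be a finitely presented $N$-act. Suppose that one of the following holds: (1) $A$ is trivial (has exactly one element); (2) $N$ is trivial; (3) $N$ contains a left zero (an element $z$ with $zn=z$ for all $n\in N$); (4) $A$ is finite and $N$ is a finitely generated monoid. Then the $\mathcal{W}(M,N|A)$-act $A\wr B$ is finitely presented.
   Context: For a monoid $M$ with identity $1$, an $M$-act is a non-empty set $A$ with a map $A\times M\to A$, $(a,m)\mapsto am$, such that $a(mn)=(am)n$ and $a1=a$. For a non-empty set $X$, $F_X$ is the free $M$-act $X\times M$ with action $(x,m)n=(x,mn)$. A congruence on an $M$-act is an equivalence relation $\rho$ such that $(a,b)\in\rho$ implies $(am,bm)\in\rho$ for all $m\in M$. An $M$-act $A$ is defined by the presentation $\langle X\,|\,R\rangle$, where $R\subseteq F_X\times F_X$, if $A\cong F_X/\rho$ with $\rho$ the smallest congruence on $F_X$ containing $R$; $A$ is finitely presented if it is defined by some presentation $\langle X\,|\,R\rangle$ with $X$ and $R$ finite. Wreath products: let $M,N$ be monoids, $A$ an $M$-act, $B$ an $N$-act. $N^A$ is the monoid of all maps $A\to N$ (written on the right) under pointwise multiplication $a(\theta\phi)=(a\theta)(a\phi)$. For $m\in M$ and $\phi\in N^A$, ${}^m\phi\in N^A$ is given by $a\,{}^m\phi=(am)\phi$. The monoid $\mathcal{W}(M,N|A)$ is the set $M\times N^A$ with multiplication $(m,\theta)(n,\phi)=(mn,\theta\,{}^m\phi)$. The wreath product $A\wr B$ is the $\mathcal{W}(M,N|A)$-act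 with underlying set $A\times B$ and action $(a,b)(m,\theta)=(am,b(a\theta))$. *)

theory Defs
  imports Complex_Main "HOL-Algebra.Group" "HOL-Library.FuncSet"
begin

locale right_act = monoid M for M (structure) +
  fixes A :: "'a set" and act :: "'a \<Rightarrow> 'm \<Rightarrow> 'a"
  assumes nonempty: "A \<noteq> {}"
    and act_closed: "\<lbrakk>a \<in> A; m \<in> carrier M\<rbrakk> \<Longrightarrow> act a m \<in> A"
    and act_mult: "\<lbrakk>a \<in> A; m \<in> carrier M; n \<in> carrier M\<rbrakk> \<Longrightarrow> act a (m \<otimes> n) = act (act a m) n"
    and act_one: "a \<in> A \<Longrightarrow> act a \<one> = a"

definition act_isomorphism ::
  "('m, 'r) monoid_scheme \<Rightarrow> 'a set \<Rightarrow> ('a \<Rightarrow> 'm \<Rightarrow> 'a) \<Rightarrow> 'b set \<Rightarrow> ('b \<Rightarrow> 'm \<Rightarrow> 'b) \<Rightarrow> ('a \<Rightarrow> 'b) \<Rightarrow> bool"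
  where "act_isomorphism M A actA B actB f \<longleftrightarrow>
    bij_betw f A B \<and> (\<forall>a\<in>A. \<forall>m\<in>carrier M. f (actA a m) = actB (f a) m)"

definition act_congruence ::
  "('m, 'r) monoid_scheme \<Rightarrow> 'a set \<Rightarrow> ('a \<Rightarrow> 'm \<Rightarrow> 'a) \<Rightarrow> ('a \<times> 'a) set \<Rightarrow> bool"
  where "act_congruence M A act \<rho> \<longleftrightarrow>
    equiv A \<rho> \<and> (\<forall>(a, b)\<in>\<rho>. \<forall>m\<in>carrier M. (act a m, act b m) \<in> \<rho>)"

text \<open>The action on \<open>A // \<rho>\<close> induced by \<open>act\<close>: the union below is that of the classes of
  \<open>act a m\<close> for all representatives \<open>a\<close> of \<open>C\<close>, which coincide when \<open>\<rho>\<close> is a congruence.\<close>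

definition quotient_act :: "('a \<Rightarrow> 'm \<Rightarrow> 'a) \<Rightarrow> ('a \<times> 'a) set \<Rightarrow> 'a set \<Rightarrow> 'm \<Rightarrow> 'a set"
  where "quotient_act act \<rho> C m = (\<Union>a\<in>C. \<rho> `` {act a m})"

definition free_act_carrier :: "('m, 'r) monoid_scheme \<Rightarrow> 'x set \<Rightarrow> ('x \<times> 'm) set"
  where "free_act_carrier M X = X \<times> carrier M"

definition free_act :: "('m, 'r) monoid_scheme \<Rightarrow> 'x \<times> 'm \<Rightarrow> 'm \<Rightarrow> 'x \<times> 'm"
  where "free_act M = (\<lambda>(x, m) n. (x, m \<otimes>\<^bsub>M\<^esub> n))"

definition free_act_congruence_generated ::
  "('m, 'r) monoid_scheme \<Rightarrow> 'x set \<Rightarrow> (('x \<times> 'm) \<times> ('x \<times> 'm)) set \<Rightarrow> (('x \<times> 'm) \<times> ('x \<times> 'm)) set"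
  where "free_act_congruence_generated M X R =
    act_congruence M (free_act_carrier M X) (free_act M) hull R"

definition act_presented_by ::
  "('m, 'r) monoid_scheme \<Rightarrow> 'a set \<Rightarrow> ('a \<Rightarrow> 'm \<Rightarrow> 'a) \<Rightarrow> 'x set \<Rightarrow> (('x \<times> 'm) \<times> ('x \<times> 'm)) set \<Rightarrow> bool"
  where "act_presented_by M A act X R \<longleftrightarrow>
    X \<noteq> {} \<and> R \<subseteq> free_act_carrier M X \<times> free_act_carrier M X \<and>
    (\<exists>f. act_isomorphism M A act
      (free_act_carrier M X // free_act_congruence_generated M X R)
      (quotient_act (free_act M) (free_act_congruence_generated M X R)) f)"

text \<open>HOL cannot quantify existentially over the type of the generating set, so the finite set
  \<open>X\<close> is taken among the sets of natural numbers. This loses nothing; see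
  \<open>finitely_presented_actI\<close> below.\<close>

definition finitely_presented_act ::
  "('m, 'r) monoid_scheme \<Rightarrow> 'a set \<Rightarrow> ('a \<Rightarrow> 'm \<Rightarrow> 'a) \<Rightarrow> bool"
  where "finitely_presented_act M A act \<longleftrightarrow> right_act M A act \<and>
    (\<exists>(X :: nat set) R. finite X \<and> finite R \<and> act_presented_by M A act X R)"

definition finitely_generated_monoid :: "('m, 'r) monoid_scheme \<Rightarrow> bool"
  where "finitely_generated_monoid M \<longleftrightarrow>
    (\<exists>S. finite S \<and> S \<subseteq> carrier M \<and> (\<lambda>H. submonoid H M) hull S = carrier M)"

text \<open>Maps \<open>A \<rightarrow> N\<close> are represented by extensional functions, with value \<open>undefined\<close>
  outside \<open>A\<close>, so that each map has exactly one representative. The map \<open>\<phi>\<close> with left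
  superscript \<open>m\<close> is \<open>twist A act m \<phi>\<close>.\<close>

definition maps_monoid :: "'a set \<Rightarrow> ('n, 's) monoid_scheme \<Rightarrow> ('a \<Rightarrow> 'n) monoid"
  where "maps_monoid A N =
    \<lparr>carrier = A \<rightarrow>\<^sub>E carrier N,
     mult = (\<lambda>\<theta> \<phi>. \<lambda>a\<in>A. \<theta> a \<otimes>\<^bsub>N\<^esub> \<phi> a),
     one = (\<lambda>a\<in>A. \<one>\<^bsub>N\<^esub>)\<rparr>"

definition twist :: "'a set \<Rightarrow> ('a \<Rightarrow> 'm \<Rightarrow> 'a) \<Rightarrow> 'm \<Rightarrow> ('a \<Rightarrow> 'n) \<Rightarrow> 'a \<Rightarrow> 'n"
  where "twist A act m \<phi> = (\<lambda>a\<in>A. \<phi> (act a m))"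

definition wreath_monoid ::
  "('m, 'r) monoid_scheme \<Rightarrow> ('n, 's) monoid_scheme \<Rightarrow> 'a set \<Rightarrow> ('a \<Rightarrow> 'm \<Rightarrow> 'a) \<Rightarrow> ('m \<times> ('a \<Rightarrow> 'n)) monoid"
  where "wreath_monoid M N A act =
    \<lparr>carrier = carrier M \<times> carrier (maps_monoid A N),
     mult = (\<lambda>(m, \<theta>) (n, \<phi>). (m \<otimes>\<^bsub>M\<^esub> n, \<theta> \<otimes>\<^bsub>maps_monoid A N\<^esub> twist A act m \<phi>)),
     one = (\<one>\<^bsub>M\<^esub>, \<one>\<^bsub>maps_monoid A N\<^esub>)\<rparr>"

definition wreath_act ::
  "('a \<Rightarrow> 'm \<Rightarrow> 'a) \<Rightarrow> ('b \<Rightarrow> 'n \<Rightarrow> 'b) \<Rightarrow> 'a \<times> 'b \<Rightarrow> 'm \<times> ('a \<Rightarrow> 'n) \<Rightarrow> 'a \<times> 'b"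
  where "wreath_act actA actB = (\<lambda>(a, b) (m, \<theta>). (actA a m, actB b (\<theta> a)))"

lemma right_act_free_act:
  assumes "monoid M" "X \<noteq> {}"
  shows "right_act M (free_act_carrier M X) (free_act M)"
proof -
  interpret monoid M by fact
  show ?thesis
    by unfold_locales (use assms(2) in \<open>auto simp: free_act_carrier_def free_act_def m_assoc\<close>)
qed

lemma (in right_act) act_congruence_hull:
  assumes "R \<subseteq> A \<times> A"
  shows "act_congruence M A act (act_congruence M A act hull R)"
proof -
  define H where "H = act_congruence M A act hull R"
  have mem: "p \<in> H \<longleftrightarrow> (\<forall>\<rho>. act_congruence M A act \<rho> \<longrightarrow> R \<subseteq> \<rho> \<longrightarrow> p \<in> \<rho>)" for p
    by (auto simp: H_def hull_def)
  have full: "act_congruence M A act (A \<times> A)"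
    by (auto simp: act_congruence_def equiv_def refl_on_def sym_def trans_def act_closed)
  have "H \<subseteq> A \<times> A"
    using full assms mem by blast
  moreover have "refl_on A H"
    by (auto simp: mem refl_on_def act_congruence_def equiv_def)
  moreover have "sym H"
    by (auto simp: mem sym_def act_congruence_def equiv_def)
  moreover have "trans H"
    unfolding trans_def mem by (meson act_congruence_def equiv_def transE)
  moreover have "(act a m, act b m) \<in> H" if "(a, b) \<in> H" "m \<in> carrier M" for a b m
    using that by (fastforce simp: mem act_congruence_def)
  ultimately have "act_congruence M A act H"
    unfolding act_congruence_def by (auto intro: equivI)
  then show ?thesis by (simp add: H_def)
qed

lemma quotient_act_class:
  assumes "act_congruence M A act \<rho>" "a \<in> A" "m \<in> carrier M"
  shows "quotient_act act \<rho> (\<rho> `` {a}) m = \<rho> `` {act a m}"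
proof -
  have eq: "equiv A \<rho>" using assms(1) by (simp add: act_congruence_def)
  have "\<rho> `` {act b m} = \<rho> `` {act a m}" if "b \<in> \<rho> `` {a}" for b
  proof -
    have "(act a m, act b m) \<in> \<rho>"
      using that assms(1,3) unfolding act_congruence_def by blast
    then show ?thesis using equiv_class_eq[OF eq] by metis
  qed
  moreover have "a \<in> \<rho> `` {a}" using eq assms(2) by (rule equiv_class_self)
  ultimately show ?thesis unfolding quotient_act_def by blast
qed

lemma monoid_wreath_monoid:
  assumes "right_act M A act" "monoid N"
  shows "monoid (wreath_monoid M N A act)"
proof -
  interpret M: right_act M A act by fact
  interpret N: monoid N by fact
  have mem: "\<theta> a \<in> carrier N" if "\<theta> \<in> A \<rightarrow>\<^sub>E carrier N" "a \<in> A" for \<theta> a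
    using that by (rule PiE_mem)
  have ext: "restrict \<theta>' A = \<theta>"
    if "\<theta> \<in> A \<rightarrow>\<^sub>E carrier N" "\<And>a. a \<in> A \<Longrightarrow> \<theta>' a = \<theta> a" for \<theta> \<theta>'
    using that by (metis PiE_restrict restrict_ext)
  show ?thesis
  proof (rule monoidI, goal_cases)
    case (1 x y)
    then show ?case
      by (auto simp: wreath_monoid_def maps_monoid_def twist_def M.act_closed mem)
  next
    case 2
    then show ?case by (auto simp: wreath_monoid_def maps_monoid_def)
  next
    case (3 x y z)
    then show ?case
      by (auto simp: wreath_monoid_def maps_monoid_def twist_def M.m_assoc M.act_closed M.act_mult
          N.m_assoc mem intro!: restrict_ext)
  next
    case (4 x)
    then show ?case
      by (auto simp: wreath_monoid_def maps_monoid_def twist_def M.act_one mem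
          intro!: ext)
  next
    case (5 x)
    then show ?case
      by (auto simp: wreath_monoid_def maps_monoid_def twist_def M.act_closed mem
          intro!: ext)
  qed
qed

lemma right_act_wreath_act:
  assumes "right_act M A actA" "right_act N B actB"
  shows "right_act (wreath_monoid M N A actA) (A \<times> B) (wreath_act actA actB)"
proof -
  interpret M: right_act M A actA by fact
  interpret N: right_act N B actB by fact
  interpret W: monoid "wreath_monoid M N A actA"
    by (rule monoid_wreath_monoid) (fact assms, unfold_locales)
  have mem: "\<theta> a \<in> carrier N" if "\<theta> \<in> A \<rightarrow>\<^sub>E carrier N" "a \<in> A" for \<theta> a
    using that by (rule PiE_mem)
  show ?thesis
    by unfold_locales
       (auto simp: wreath_act_def wreath_monoid_def maps_monoid_def twist_def
          M.nonempty N.nonempty M.act_closed N.act_closed M.act_mult N.act_mult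
          M.act_one N.act_one mem)
qed


lemma act_congruence_pullback:
  assumes g: "bij_betw g A' A"
    and closed: "\<And>a m. \<lbrakk>a \<in> A'; m \<in> carrier M\<rbrakk> \<Longrightarrow> act' a m \<in> A'"
    and hom: "\<And>a m. \<lbrakk>a \<in> A'; m \<in> carrier M\<rbrakk> \<Longrightarrow> g (act' a m) = act (g a) m"
    and \<rho>: "act_congruence M A act \<rho>"
  shows "act_congruence M A' act' {(a, b) \<in> A' \<times> A'. (g a, g b) \<in> \<rho>}"
proof -
  have "equiv A \<rho>" using \<rho> by (simp add: act_congruence_def)
  then have "equiv A' {(a, b) \<in> A' \<times> A'. (g a, g b) \<in> \<rho>}"
    using bij_betwE[OF g] unfolding equiv_def refl_on_def sym_def trans_def by blast
  then show ?thesis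
    using \<rho> closed hom unfolding act_congruence_def by auto
qed

lemma finitely_presented_actI:
  fixes M :: "('m, 'r) monoid_scheme" and X :: "'x set"
  assumes act: "right_act M A act" and fin: "finite X" "finite R"
    and pres: "act_presented_by M A act X R"
  shows "finitely_presented_act M A act"
proof -
  interpret right_act M A act by fact
  obtain e :: "nat \<Rightarrow> 'x" where e: "bij_betw e {0..<card X} X"
    using fin(1) ex_bij_betw_nat_finite by blast
  define Y where "Y = {0..<card X}"
  define g :: "nat \<times> 'm \<Rightarrow> 'x \<times> 'm" where "g = map_prod e id"
  define k where "k = inv_into (free_act_carrier M Y) g"
  let ?F = "free_act_carrier M X" and ?G = "free_act_carrier M Y" and ?a = "free_act M"
  have X: "X \<noteq> {}" and R: "R \<subseteq> ?F \<times> ?F" using pres by (auto simp: act_presented_by_def)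
  have Y: "Y \<noteq> {}" using X fin(1) by (auto simp: Y_def)
  interpret F: right_act M ?F ?a by (rule right_act_free_act) (unfold_locales, fact X)
  interpret G: right_act M ?G ?a by (rule right_act_free_act) (unfold_locales, fact Y)
  have g: "bij_betw g ?G ?F"
    unfolding g_def free_act_carrier_def using e Y_def
    by (intro bij_betw_map_prod) (auto simp: bij_betw_def)
  have k: "bij_betw k ?F ?G" unfolding k_def using g by (rule bij_betw_inv_into)
  have gF: "g p \<in> ?F" if "p \<in> ?G" for p using bij_betwE[OF g] that by blast
  have kG: "k p \<in> ?G" if "p \<in> ?F" for p using bij_betwE[OF k] that by blast
  have gk: "g (k p) = p" if "p \<in> ?F" for p
    unfolding k_def using g that by (rule bij_betw_inv_into_right)
  have kg: "k (g p) = p" if "p \<in> ?G" for p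
    unfolding k_def using g that by (rule bij_betw_inv_into_left)
  have hom_g: "g (?a p m) = ?a (g p) m" for p m
    by (cases p) (simp add: g_def free_act_def)
  have hom_k: "k (?a p m) = ?a (k p) m" if "p \<in> ?F" "m \<in> carrier M" for p m
    using that gk kg hom_g kG G.act_closed by metis
  define S where "S = map_prod k k ` R"
  have S: "S \<subseteq> ?G \<times> ?G" using R kG by (auto simp: S_def)
  define \<rho> where "\<rho> = free_act_congruence_generated M X R"
  define \<sigma> where "\<sigma> = free_act_congruence_generated M Y S"
  have c\<rho>: "act_congruence M ?F ?a \<rho>" and R\<rho>: "R \<subseteq> \<rho>"
    unfolding \<rho>_def free_act_congruence_generated_def
    by (rule F.act_congruence_hull[OF R], rule hull_subset)
  have c\<sigma>: "act_congruence M ?G ?a \<sigma>" and S\<sigma>: "S \<subseteq> \<sigma>"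
    unfolding \<sigma>_def free_act_congruence_generated_def
    by (rule G.act_congruence_hull[OF S], rule hull_subset)
  have "act_congruence M ?G ?a {(a, b) \<in> ?G \<times> ?G. (g a, g b) \<in> \<rho>}"
    using g G.act_closed hom_g c\<rho> by (rule act_congruence_pullback)
  moreover have "S \<subseteq> {(a, b) \<in> ?G \<times> ?G. (g a, g b) \<in> \<rho>}"
  proof
    fix p assume "p \<in> S"
    then obtain a b where "(a, b) \<in> R" "p = (k a, k b)" by (auto simp: S_def)
    moreover from this have "a \<in> ?F" "b \<in> ?F" using R by auto
    ultimately show "p \<in> {(a, b) \<in> ?G \<times> ?G. (g a, g b) \<in> \<rho>}"
      using R\<rho> kG gk by auto
  qed
  ultimately have \<sigma>\<rho>: "\<sigma> \<subseteq> {(a, b) \<in> ?G \<times> ?G. (g a, g b) \<in> \<rho>}"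
    unfolding \<sigma>_def free_act_congruence_generated_def by (simp only: hull_minimal[where S = "act_congruence M ?G ?a"])
  have "act_congruence M ?F ?a {(a, b) \<in> ?F \<times> ?F. (k a, k b) \<in> \<sigma>}"
    using k F.act_closed hom_k c\<sigma> by (rule act_congruence_pullback)
  moreover have "R \<subseteq> {(a, b) \<in> ?F \<times> ?F. (k a, k b) \<in> \<sigma>}"
  proof
    fix p assume "p \<in> R"
    moreover from this have "map_prod k k p \<in> \<sigma>" using S\<sigma> unfolding S_def by blast
    ultimately show "p \<in> {(a, b) \<in> ?F \<times> ?F. (k a, k b) \<in> \<sigma>}"
      using R by (cases p) auto
  qed
  ultimately have \<rho>\<sigma>: "\<rho> \<subseteq> {(a, b) \<in> ?F \<times> ?F. (k a, k b) \<in> \<sigma>}"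
    unfolding \<rho>_def free_act_congruence_generated_def by (simp only: hull_minimal[where S = "act_congruence M ?F ?a"])
  have iff: "(a, b) \<in> \<rho> \<longleftrightarrow> (k a, k b) \<in> \<sigma>" if "a \<in> ?F" "b \<in> ?F" for a b
  proof
    show "(k a, k b) \<in> \<sigma>" if "(a, b) \<in> \<rho>" using that \<rho>\<sigma> by auto
    assume "(k a, k b) \<in> \<sigma>"
    then have "(g (k a), g (k b)) \<in> \<rho>" using \<sigma>\<rho> by auto
    then show "(a, b) \<in> \<rho>" by (simp add: gk \<open>a \<in> ?F\<close> \<open>b \<in> ?F\<close>)
  qed
  have \<rho>F: "\<rho> \<subseteq> ?F \<times> ?F" and \<sigma>G: "\<sigma> \<subseteq> ?G \<times> ?G"
    using c\<rho> c\<sigma> by (auto simp: act_congruence_def equiv_def)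
  have cls: "k ` (\<rho> `` {p}) = \<sigma> `` {k p}" if "p \<in> ?F" for p
  proof (intro equalityI subsetI)
    fix q assume "q \<in> k ` (\<rho> `` {p})"
    then show "q \<in> \<sigma> `` {k p}" using iff that \<rho>F by auto
  next
    fix q assume q: "q \<in> \<sigma> `` {k p}"
    then have "q \<in> ?G" using \<sigma>G by auto
    then have "q = k (g q)" "g q \<in> ?F" using kg gF by auto
    with q show "q \<in> k ` (\<rho> `` {p})" using iff[OF that, of "g q"] by auto
  qed
  have quot: "bij_betw ((`) k) (?F // \<rho>) (?G // \<sigma>)"
    unfolding bij_betw_def
  proof
    have "C \<subseteq> ?F" if "C \<in> ?F // \<rho>" for C using that \<rho>F by (auto simp: quotient_def)
    then show "inj_on ((`) k) (?F // \<rho>)"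
      by (intro inj_onI) (simp add: inj_on_image_eq_iff[OF bij_betw_imp_inj_on[OF k]])
    have "(`) k ` (?F // \<rho>) = (\<lambda>p. k ` (\<rho> `` {p})) ` ?F"
      by (simp only: quotient_def UNION_singleton_eq_range image_image)
    also have "\<dots> = (\<lambda>p. \<sigma> `` {k p}) ` ?F"
      by (rule image_cong[OF refl cls])
    also have "\<dots> = (\<lambda>q. \<sigma> `` {q}) ` (k ` ?F)" by (simp add: image_image)
    also have "\<dots> = ?G // \<sigma>"
      by (simp only: bij_betw_imp_surj_on[OF k] quotient_def UNION_singleton_eq_range)
    finally show "(`) k ` (?F // \<rho>) = ?G // \<sigma>" .
  qed
  have qhom: "k ` quotient_act ?a \<rho> C m = quotient_act ?a \<sigma> (k ` C) m"
    if C: "C \<in> ?F // \<rho>" and m: "m \<in> carrier M" for C m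
  proof -
    obtain p where p: "p \<in> ?F" "C = \<rho> `` {p}" using C by (rule quotientE)
    then show ?thesis
      using m
      by (simp add: cls quotient_act_class[OF c\<rho>] quotient_act_class[OF c\<sigma>] kG hom_k F.act_closed)
  qed
  obtain f where f: "act_isomorphism M A act (?F // \<rho>) (quotient_act ?a \<rho>) f"
    using pres unfolding act_presented_by_def \<rho>_def by blast
  then have bf: "bij_betw f A (?F // \<rho>)"
    and hf: "\<And>a m. \<lbrakk>a \<in> A; m \<in> carrier M\<rbrakk> \<Longrightarrow> f (act a m) = quotient_act ?a \<rho> (f a) m"
    by (simp_all add: act_isomorphism_def)
  have "bij_betw ((`) k \<circ> f) A (?G // \<sigma>)"
    using bf quot by (rule bij_betw_trans)
  moreover have "((`) k \<circ> f) (act a m) = quotient_act ?a \<sigma> (((`) k \<circ> f) a) m"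
    if "a \<in> A" "m \<in> carrier M" for a m
    using hf[OF that] qhom[OF bij_betwE[OF bf, rule_format, OF that(1)] that(2)] by simp
  ultimately have "act_isomorphism M A act (?G // \<sigma>) (quotient_act ?a \<sigma>) ((`) k \<circ> f)"
    by (simp add: act_isomorphism_def)
  then have "act_presented_by M A act Y S"
    using Y S unfolding act_presented_by_def \<sigma>_def by blast
  moreover have "finite Y" "finite S" using fin by (auto simp: Y_def S_def)
  ultimately show ?thesis using act unfolding finitely_presented_act_def by blast
qed

end

theory Submission
  imports Defs
begin

text \<open>Choose finite presentations of \<open>A\<close> over \<open>X\<close> and of \<open>B\<close> over \<open>Y\<close>.
  The act \<open>A \<wr> B\<close> is generated by \<open>X \<times> Y\<close>, and the given relations lift along
  \<open>m \<mapsto> (m, 1)\<close> and along the constant maps \<open>n \<mapsto> (1, c\<^sub>n)\<close>. What is missing is to replace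
  \<open>(x, y)(1, \<theta>)\<close> by \<open>(x, y)(1, c\<^sub>n)\<close>, where \<open>n\<close> is the value of \<open>\<theta>\<close> at \<open>x\<close>. Finitely many
  relations achieve this as soon as the kernel of evaluation at \<open>x\<close>, a right congruence on \<open>N\<^sup>A\<close>,
  is finitely generated. With a left zero \<open>z\<close>, a single pair \<open>(\<epsilon>, 1)\<close> generates it, where
  \<open>\<epsilon>\<close> is \<open>1\<close> at \<open>x\<close> and \<open>z\<close> elsewhere; with \<open>A\<close> finite and \<open>N\<close> generated by \<open>S\<close>, the
  pairs \<open>(\<delta>, 1)\<close> do, where \<open>\<delta>\<close> takes a value of \<open>S\<close> at one point other than \<open>x\<close> and is
  \<open>1\<close> elsewhere.\<close>

section \<open>Presentations in terms of kernels\<close>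

text \<open>The kernel of the act morphism from the free act on \<open>X\<close> that sends the
  generator \<open>(x, 1)\<close> to \<open>g x\<close>. With it, presentations can be handled
  through equations in the act itself instead of classes of a hull.\<close>

definition free_act_kernel ::
  "('m, 'r) monoid_scheme \<Rightarrow> ('a \<Rightarrow> 'm \<Rightarrow> 'a) \<Rightarrow> 'x set \<Rightarrow> ('x \<Rightarrow> 'a) \<Rightarrow> (('x \<times> 'm) \<times> ('x \<times> 'm)) set"
  where "free_act_kernel M act X g = {((x, m), (y, n)).
    x \<in> X \<and> y \<in> X \<and> m \<in> carrier M \<and> n \<in> carrier M \<and> act (g x) m = act (g y) n}"

text \<open>The monoid may change along \<open>u\<close>. This is what carries a congruence on the
  free act over the wreath monoid back to free acts over \<open>M\<close> and \<open>N\<close> and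
  to the monoid of maps.\<close>

lemma act_congruence_vimage:
  assumes \<rho>: "act_congruence M A act \<rho>"
    and j: "\<And>a. a \<in> A' \<Longrightarrow> j a \<in> A"
    and u: "\<And>m. m \<in> carrier M' \<Longrightarrow> u m \<in> carrier M"
    and closed: "\<And>a m. \<lbrakk>a \<in> A'; m \<in> carrier M'\<rbrakk> \<Longrightarrow> act' a m \<in> A'"
    and hom: "\<And>a m. \<lbrakk>a \<in> A'; m \<in> carrier M'\<rbrakk> \<Longrightarrow> j (act' a m) = act (j a) (u m)"
  shows "act_congruence M' A' act' {(a, b) \<in> A' \<times> A'. (j a, j b) \<in> \<rho>}"
proof -
  have "equiv A \<rho>" using \<rho> by (simp add: act_congruence_def)
  then have "equiv A' {(a, b) \<in> A' \<times> A'. (j a, j b) \<in> \<rho>}"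
    using j unfolding equiv_def refl_on_def sym_def trans_def by blast
  then show ?thesis
    using \<rho> closed hom u unfolding act_congruence_def by auto
qed

lemma (in right_act) act_congruence_free_act_kernel:
  assumes "\<And>x. x \<in> X \<Longrightarrow> g x \<in> A"
  shows "act_congruence M (free_act_carrier M X) (free_act M) (free_act_kernel M act X g)"
proof -
  have "equiv (free_act_carrier M X) (free_act_kernel M act X g)"
    by (rule equivI)
      (auto simp: refl_on_def sym_def trans_def free_act_carrier_def free_act_kernel_def)
  moreover have "(free_act M p k, free_act M q k) \<in> free_act_kernel M act X g"
    if "(p, q) \<in> free_act_kernel M act X g" "k \<in> carrier M" for p q k
    using that assms by (auto simp: free_act_kernel_def free_act_def act_mult)
  ultimately show ?thesis
    unfolding act_congruence_def by auto
qed

text \<open>The isomorphism with the quotient identifies the generated congruence with the kernel of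
  a morphism given by elements \<open>g x\<close>. Its minimality is stated against every congruence
  \<sigma>, so that it applies directly to preimages of congruences.\<close>

lemma finitely_presented_actE:
  assumes "finitely_presented_act M A act"
  obtains X :: "nat set" and g R where "finite X" "\<And>x. x \<in> X \<Longrightarrow> g x \<in> A"
    "\<And>a. a \<in> A \<Longrightarrow> \<exists>x\<in>X. \<exists>m\<in>carrier M. act (g x) m = a"
    "finite R" "R \<subseteq> free_act_kernel M act X g"
    "\<And>\<sigma>. act_congruence M (free_act_carrier M X) (free_act M) \<sigma> \<Longrightarrow> R \<subseteq> \<sigma>
      \<Longrightarrow> free_act_kernel M act X g \<subseteq> \<sigma>"
proof -
  interpret right_act M A act using assms by (simp add: finitely_presented_act_def)
  obtain X :: "nat set" and R where fin: "finite X" "finite R" and pres: "act_presented_by M A act X R"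
    using assms by (auto simp: finitely_presented_act_def)
  let ?F = "free_act_carrier M X" and ?a = "free_act M"
  define \<rho> where "\<rho> = free_act_congruence_generated M X R"
  have X: "X \<noteq> {}" and R: "R \<subseteq> ?F \<times> ?F" using pres by (auto simp: act_presented_by_def)
  obtain f where f: "act_isomorphism M A act (?F // \<rho>) (quotient_act ?a \<rho>) f"
    using pres unfolding act_presented_by_def \<rho>_def by blast
  interpret F: right_act M ?F ?a by (rule right_act_free_act) (unfold_locales, fact X)
  have c: "act_congruence M ?F ?a \<rho>" and R\<rho>: "R \<subseteq> \<rho>"
    unfolding \<rho>_def free_act_congruence_generated_def
    by (rule F.act_congruence_hull[OF R], rule hull_subset)
  then have eq: "equiv ?F \<rho>" by (simp add: act_congruence_def)
  have bij: "bij_betw f A (?F // \<rho>)"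
    and hom: "\<And>a m. \<lbrakk>a \<in> A; m \<in> carrier M\<rbrakk> \<Longrightarrow> f (act a m) = quotient_act ?a \<rho> (f a) m"
    using f by (simp_all add: act_isomorphism_def)
  \<comment> \<open>\<open>g x\<close> is the element of \<open>A\<close> that corresponds to the
    class of the generator \<open>(x, 1)\<close>.\<close>
  define g where "g x = inv_into A f (\<rho> `` {(x, \<one>\<^bsub>M\<^esub>)})" for x
  have F1: "(x, \<one>\<^bsub>M\<^esub>) \<in> ?F" if "x \<in> X" for x using that by (simp add: free_act_carrier_def)
  have fg: "f (g x) = \<rho> `` {(x, \<one>\<^bsub>M\<^esub>)}" if "x \<in> X" for x
    unfolding g_def by (rule bij_betw_inv_into_right[OF bij]) (rule quotientI[OF F1[OF that]])
  have gA: "g x \<in> A" if "x \<in> X" for x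
    using bij_betw_apply[OF bij_betw_inv_into[OF bij]] quotientI[OF F1[OF that]]
    by (simp add: g_def)
  have fgm: "f (act (g x) m) = \<rho> `` {(x, m)}" if "x \<in> X" "m \<in> carrier M" for x m
    using that by (simp add: hom gA fg quotient_act_class[OF c F1]) (simp add: free_act_def)
  have inj: "a = b" if "f a = f b" "a \<in> A" "b \<in> A" for a b
    using that bij by (auto simp: bij_betw_def inj_on_def)
  \<comment> \<open>Injectivity of \<open>f\<close> turns equality in \<open>A\<close> into equality
    of classes.\<close>
  have ker: "act (g x) m = act (g y) n \<longleftrightarrow> ((x, m), (y, n)) \<in> \<rho>"
    if "x \<in> X" "y \<in> X" "m \<in> carrier M" "n \<in> carrier M" for x y m n
  proof -
    have "act (g x) m = act (g y) n \<longleftrightarrow> \<rho> `` {(x, m)} = \<rho> `` {(y, n)}"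
      using that by (metis fgm inj gA act_closed)
    then show ?thesis
      using eq_equiv_class_iff[OF eq, of "(x, m)" "(y, n)"] that
      by (simp add: free_act_carrier_def)
  qed
  have \<rho>F: "\<rho> \<subseteq> ?F \<times> ?F" using eq by (auto simp: equiv_def)
  have "p \<in> free_act_kernel M act X g \<longleftrightarrow> p \<in> \<rho>" for p
  proof -
    obtain x m y n where p: "p = ((x, m), (y, n))" by (metis surj_pair)
    have "p \<in> \<rho> \<Longrightarrow> x \<in> X \<and> y \<in> X \<and> m \<in> carrier M \<and> n \<in> carrier M"
      using \<rho>F by (auto simp: p free_act_carrier_def)
    then show ?thesis using ker[of x y m n] unfolding p free_act_kernel_def by blast
  qed
  then have "free_act_kernel M act X g = \<rho>" by blast
  moreover have "\<exists>x\<in>X. \<exists>m\<in>carrier M. act (g x) m = a" if a: "a \<in> A" for a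
  proof -
    have "f a \<in> ?F // \<rho>" using bij a by (auto simp: bij_betw_def)
    then obtain x m where "x \<in> X" "m \<in> carrier M" "f a = \<rho> `` {(x, m)}"
      by (auto simp: free_act_carrier_def elim!: quotientE)
    then show ?thesis using inj[of "act (g x) m" a] a by (metis fgm gA act_closed)
  qed
  moreover have "\<rho> \<subseteq> \<sigma>" if "act_congruence M ?F ?a \<sigma>" "R \<subseteq> \<sigma>" for \<sigma>
    unfolding \<rho>_def free_act_congruence_generated_def using that by (simp add: hull_minimal)
  ultimately show thesis
    by (intro that[of X g R]) (use fin gA R\<rho> in simp_all)
qed

text \<open>The converse of \<open>finitely_presented_actE\<close>, by the first isomorphism
  theorem. The type of \<open>X\<close> is arbitrary, so that pairs of generators can serve as
  generators of the wreath product.\<close>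

lemma (in right_act) finitely_presented_act_kernelI:
  fixes X :: "'x set"
  assumes fin: "finite X" "finite R"
    and g: "\<And>x. x \<in> X \<Longrightarrow> g x \<in> A"
    and gen: "\<And>a. a \<in> A \<Longrightarrow> \<exists>x\<in>X. \<exists>m\<in>carrier M. act (g x) m = a"
    and R: "R \<subseteq> free_act_kernel M act X g"
    and ker: "\<And>\<sigma>. act_congruence M (free_act_carrier M X) (free_act M) \<sigma> \<Longrightarrow> R \<subseteq> \<sigma>
      \<Longrightarrow> free_act_kernel M act X g \<subseteq> \<sigma>"
  shows "finitely_presented_act M A act"
proof -
  let ?F = "free_act_carrier M X" and ?a = "free_act M"
  define \<rho> where "\<rho> = free_act_kernel M act X g"
  define h where "h = (\<lambda>(x, m). act (g x) m)"
  have X: "X \<noteq> {}" using gen nonempty by blast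
  interpret F: right_act M ?F ?a by (rule right_act_free_act) (unfold_locales, fact X)
  have c: "act_congruence M ?F ?a \<rho>"
    unfolding \<rho>_def using g by (rule act_congruence_free_act_kernel)
  have \<rho>F: "\<rho> \<subseteq> ?F \<times> ?F" by (auto simp: \<rho>_def free_act_kernel_def free_act_carrier_def)
  then have RF: "R \<subseteq> ?F \<times> ?F" using R by (simp add: \<rho>_def)
  have gen\<rho>: "free_act_congruence_generated M X R = \<rho>"
    unfolding free_act_congruence_generated_def
  proof (rule hull_unique)
    show "R \<subseteq> \<rho>" using R by (simp add: \<rho>_def)
  qed (use c ker \<rho>_def in auto)
  have mem: "(p, q) \<in> \<rho> \<longleftrightarrow> p \<in> ?F \<and> q \<in> ?F \<and> h p = h q" for p q
    by (cases p; cases q) (auto simp: \<rho>_def free_act_kernel_def free_act_carrier_def h_def)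
  \<comment> \<open>The isomorphism sends an element to its fibre under \<open>h\<close>. The
    classes of \<rho> are exactly these fibres, which are non-empty because \<open>X\<close>
    generates.\<close>
  define f where "f a = {p \<in> ?F. h p = a}" for a
  have cls: "\<rho> `` {p} = f (h p)" if "p \<in> ?F" for p using that by (auto simp: mem f_def)
  have surj: "\<exists>p\<in>?F. h p = a" if "a \<in> A" for a
    using gen[OF that] by (auto simp: free_act_carrier_def h_def)
  have hA: "h p \<in> A" if "p \<in> ?F" for p
    using that g by (auto simp: free_act_carrier_def h_def intro: act_closed)
  have hm: "h (?a p m) = act (h p) m" if "p \<in> ?F" "m \<in> carrier M" for p m
    using that g by (auto simp: free_act_carrier_def h_def free_act_def act_mult)
  have "bij_betw f A (?F // \<rho>)"
    unfolding bij_betw_def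
  proof
    show "inj_on f A"
      by (rule inj_onI) (use surj f_def in blast)
    show "f ` A = ?F // \<rho>"
    proof (intro equalityI subsetI)
      fix C assume "C \<in> f ` A"
      then obtain p where "p \<in> ?F" "C = f (h p)" using surj by blast
      then show "C \<in> ?F // \<rho>" by (metis cls quotientI)
    next
      fix C assume "C \<in> ?F // \<rho>"
      then show "C \<in> f ` A" by (rule quotientE) (simp add: cls hA)
    qed
  qed
  moreover have "f (act a m) = quotient_act ?a \<rho> (f a) m" if a: "a \<in> A" and m: "m \<in> carrier M" for a m
  proof -
    obtain p where p: "p \<in> ?F" "h p = a" using surj[OF a] by blast
    then have "quotient_act ?a \<rho> (f a) m = \<rho> `` {?a p m}"
      using quotient_act_class[OF c p(1) m] by (simp add: cls)
    then show ?thesis using p m by (simp add: cls F.act_closed hm)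
  qed
  ultimately have "act_presented_by M A act X R"
    using X RF unfolding act_presented_by_def gen\<rho> act_isomorphism_def by blast
  then show ?thesis using fin right_act_axioms by (intro finitely_presented_actI)
qed

section \<open>The kernel of evaluation\<close>

definition eval_kernel :: "'a set \<Rightarrow> ('n, 's) monoid_scheme \<Rightarrow> 'a \<Rightarrow> (('a \<Rightarrow> 'n) \<times> ('a \<Rightarrow> 'n)) set"
  where "eval_kernel A N a =
    {(\<theta>, \<phi>). \<theta> \<in> A \<rightarrow>\<^sub>E carrier N \<and> \<phi> \<in> A \<rightarrow>\<^sub>E carrier N \<and> \<theta> a = \<phi> a}"

text \<open>Phrased through the regular right act, so that \<open>act_congruence_vimage\<close>
  yields right congruences as well.\<close>

definition right_congruence :: "('m, 'r) monoid_scheme \<Rightarrow> ('m \<times> 'm) set \<Rightarrow> bool"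
  where "right_congruence M \<sigma> \<longleftrightarrow> act_congruence M (carrier M) (mult M) \<sigma>"

text \<open>The condition at the point \<open>a\<close> to which all four cases of the theorem are
  reduced.\<close>

definition eval_kernel_finitely_generated :: "'a set \<Rightarrow> ('n, 's) monoid_scheme \<Rightarrow> 'a \<Rightarrow> bool"
  where "eval_kernel_finitely_generated A N a \<longleftrightarrow>
    (\<exists>K. finite K \<and> K \<subseteq> eval_kernel A N a \<and>
      (\<forall>\<sigma>. right_congruence (maps_monoid A N) \<sigma> \<longrightarrow> K \<subseteq> \<sigma> \<longrightarrow> eval_kernel A N a \<subseteq> \<sigma>))"

lemma right_congruenceD:
  assumes "right_congruence M \<sigma>"
  shows right_congruence_refl: "x \<in> carrier M \<Longrightarrow> (x, x) \<in> \<sigma>"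
    and right_congruence_sym: "(x, y) \<in> \<sigma> \<Longrightarrow> (y, x) \<in> \<sigma>"
    and right_congruence_trans: "\<lbrakk>(x, y) \<in> \<sigma>; (y, z) \<in> \<sigma>\<rbrakk> \<Longrightarrow> (x, z) \<in> \<sigma>"
    and right_congruence_mult:
      "\<lbrakk>(x, y) \<in> \<sigma>; m \<in> carrier M\<rbrakk> \<Longrightarrow> (x \<otimes>\<^bsub>M\<^esub> m, y \<otimes>\<^bsub>M\<^esub> m) \<in> \<sigma>"
  using assms
  by (auto simp: right_congruence_def act_congruence_def equiv_def refl_on_def
      dest: symD transD)

lemma monoid_maps_monoid:
  assumes "monoid N"
  shows "monoid (maps_monoid A N)"
proof -
  interpret monoid N by fact
  show ?thesis
    by (rule monoidI)
      (auto simp: maps_monoid_def PiE_iff extensional_def m_assoc intro!: ext)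
qed

text \<open>A kernel contained in equality lies in every right congruence by reflexivity, so the
  empty set generates it. This serves both trivial \<open>A\<close> and trivial
  \<open>N\<close>.\<close>

lemma eval_kernel_finitely_generated_trivial:
  assumes "\<And>\<theta> \<phi>. (\<theta>, \<phi>) \<in> eval_kernel A N a \<Longrightarrow> \<theta> = \<phi>"
  shows "eval_kernel_finitely_generated A N a"
proof -
  have "eval_kernel A N a \<subseteq> \<sigma>" if \<sigma>: "right_congruence (maps_monoid A N) \<sigma>" for \<sigma>
  proof
    fix p assume p: "p \<in> eval_kernel A N a"
    then have "fst p \<in> carrier (maps_monoid A N)" "snd p = fst p"
      using assms[of "fst p" "snd p"] by (auto simp: eval_kernel_def maps_monoid_def)
    then show "p \<in> \<sigma>" using right_congruence_refl[OF \<sigma>] by (metis prod.collapse)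
  qed
  then show ?thesis
    unfolding eval_kernel_finitely_generated_def by (intro exI[of _ "{}"]) auto
qed

text \<open>Left multiplication by \<epsilon> erases all values away from \<open>a\<close>, since
  \<open>z\<close> absorbs whatever stands to its right. Hence the product of \<epsilon> and
  \<theta> is a normal form of \<theta> that depends only on \<open>\<theta> a\<close>.\<close>

lemma eval_kernel_finitely_generated_left_zero:
  assumes "monoid N" "z \<in> carrier N" and zero: "\<And>n. n \<in> carrier N \<Longrightarrow> z \<otimes>\<^bsub>N\<^esub> n = z"
    and "a \<in> A"
  shows "eval_kernel_finitely_generated A N a"
proof -
  interpret N: monoid N by fact
  define \<epsilon> where "\<epsilon> = (\<lambda>b\<in>A. if b = a then \<one>\<^bsub>N\<^esub> else z)"
  let ?P = "maps_monoid A N"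
  interpret P: monoid ?P using \<open>monoid N\<close> by (rule monoid_maps_monoid)
  have "eval_kernel A N a \<subseteq> \<sigma>"
    if \<sigma>: "right_congruence ?P \<sigma>" and K: "{(\<epsilon>, \<one>\<^bsub>?P\<^esub>)} \<subseteq> \<sigma>" for \<sigma>
  proof
    \<comment> \<open>Multiplying the single generating pair by \<theta> on the right relates
      \<theta> to its normal form.\<close>
    have red: "(\<epsilon> \<otimes>\<^bsub>?P\<^esub> \<theta>, \<theta>) \<in> \<sigma>" if \<theta>: "\<theta> \<in> A \<rightarrow>\<^sub>E carrier N" for \<theta>
    proof -
      have "(\<epsilon> \<otimes>\<^bsub>?P\<^esub> \<theta>, \<one>\<^bsub>?P\<^esub> \<otimes>\<^bsub>?P\<^esub> \<theta>) \<in> \<sigma>"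
        using right_congruence_mult[OF \<sigma>, of \<epsilon> "\<one>\<^bsub>?P\<^esub>" \<theta>] K \<theta> by (simp add: maps_monoid_def)
      moreover have "\<one>\<^bsub>?P\<^esub> \<otimes>\<^bsub>?P\<^esub> \<theta> = \<theta>"
        using P.l_one[of \<theta>] \<theta> by (simp add: maps_monoid_def)
      ultimately show ?thesis by simp
    qed
    fix p assume "p \<in> eval_kernel A N a"
    then obtain \<theta> \<phi> where p: "p = (\<theta>, \<phi>)" "\<theta> \<in> A \<rightarrow>\<^sub>E carrier N" "\<phi> \<in> A \<rightarrow>\<^sub>E carrier N" "\<theta> a = \<phi> a"
      by (auto simp: eval_kernel_def)
    then have "\<epsilon> \<otimes>\<^bsub>?P\<^esub> \<theta> = \<epsilon> \<otimes>\<^bsub>?P\<^esub> \<phi>"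
      by (auto simp: maps_monoid_def \<epsilon>_def zero PiE_iff intro!: restrict_ext)
    then show "p \<in> \<sigma>"
      using red[OF p(2)] red[OF p(3)] p(1)
      by (metis right_congruence_sym[OF \<sigma>] right_congruence_trans[OF \<sigma>])
  qed
  moreover have "{(\<epsilon>, \<one>\<^bsub>?P\<^esub>)} \<subseteq> eval_kernel A N a"
    using assms by (auto simp: eval_kernel_def maps_monoid_def \<epsilon>_def)
  ultimately show ?thesis
    unfolding eval_kernel_finitely_generated_def by blast
qed

text \<open>As \<open>A\<close> is finite, \<theta> is a finite product of maps
  \<open>\<delta> b (\<theta> b)\<close>. The factors with \<open>b\<close> different from
  \<open>a\<close> can be cancelled one by one, which leaves the normal form
  \<open>\<delta> a (\<theta> a)\<close>.\<close>

lemma eval_kernel_finitely_generated_finite: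
  assumes "monoid N" "finite A" "finitely_generated_monoid N" "a \<in> A"
  shows "eval_kernel_finitely_generated A N a"
proof -
  interpret N: monoid N by fact
  let ?P = "maps_monoid A N"
  interpret P: monoid ?P using \<open>monoid N\<close> by (rule monoid_maps_monoid)
  obtain S where S: "finite S" "S \<subseteq> carrier N" "(\<lambda>H. submonoid H N) hull S = carrier N"
    using assms(3) by (auto simp: finitely_generated_monoid_def)
  define \<delta> where "\<delta> b n = (\<lambda>c\<in>A. if c = b then n else \<one>\<^bsub>N\<^esub>)" for b n
  define K where "K = (\<lambda>(b, s). (\<delta> b s, \<one>\<^bsub>?P\<^esub>)) ` ((A - {a}) \<times> S)"
  have \<delta>P: "\<delta> b n \<in> A \<rightarrow>\<^sub>E carrier N" if "n \<in> carrier N" for b n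
    using that by (auto simp: \<delta>_def)
  have "eval_kernel A N a \<subseteq> \<sigma>" if \<sigma>: "right_congruence ?P \<sigma>" and K: "K \<subseteq> \<sigma>" for \<sigma>
  proof
    \<comment> \<open>A left factor congruent to the identity may be deleted. This is what
      compatibility on the right gives; a right factor could not be treated in the same way.\<close>
    have step: "(\<theta> \<otimes>\<^bsub>?P\<^esub> \<phi>, \<phi>) \<in> \<sigma>"
      if "(\<theta>, \<one>\<^bsub>?P\<^esub>) \<in> \<sigma>" "\<phi> \<in> A \<rightarrow>\<^sub>E carrier N" for \<theta> \<phi>
    proof -
      have "\<one>\<^bsub>?P\<^esub> \<otimes>\<^bsub>?P\<^esub> \<phi> = \<phi>"
        using P.l_one[of \<phi>] that(2) by (simp add: maps_monoid_def)
      then show ?thesis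
        using right_congruence_mult[OF \<sigma> that(1), of \<phi>] that(2) by (simp add: maps_monoid_def)
    qed
    have one: "(\<one>\<^bsub>?P\<^esub>, \<one>\<^bsub>?P\<^esub>) \<in> \<sigma>"
      by (rule right_congruence_refl[OF \<sigma>]) (auto simp: maps_monoid_def)
    have \<delta>\<sigma>: "(\<delta> b n, \<one>\<^bsub>?P\<^esub>) \<in> \<sigma>" if b: "b \<in> A" "b \<noteq> a" and n: "n \<in> carrier N" for b n
    proof -
      \<comment> \<open>The values whose point map at \<open>b\<close> is congruent to the identity
        form a submonoid: for a product \<open>k l\<close>, first delete the factor of
        \<open>k\<close>, then use the pair for \<open>l\<close>. It contains the generators
        \<open>S\<close>, hence all of \<open>N\<close>.\<close>
      let ?H = "{n \<in> carrier N. (\<delta> b n, \<one>\<^bsub>?P\<^esub>) \<in> \<sigma>}"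
      have "submonoid ?H N"
      proof
        have "\<delta> b \<one>\<^bsub>N\<^esub> = \<one>\<^bsub>?P\<^esub>" by (auto simp: \<delta>_def maps_monoid_def)
        then show "\<one>\<^bsub>N\<^esub> \<in> ?H" using one by simp
        fix k l assume kl: "k \<in> ?H" "l \<in> ?H"
        then have "\<delta> b (k \<otimes>\<^bsub>N\<^esub> l) = \<delta> b k \<otimes>\<^bsub>?P\<^esub> \<delta> b l"
          by (auto simp: \<delta>_def maps_monoid_def intro!: ext)
        then show "k \<otimes>\<^bsub>N\<^esub> l \<in> ?H"
          using kl step[of "\<delta> b k" "\<delta> b l"] \<delta>P right_congruence_trans[OF \<sigma>] by fastforce
      qed auto
      moreover have "S \<subseteq> ?H" using K b S(2) by (auto simp: K_def)
      ultimately have "carrier N \<subseteq> ?H" unfolding S(3)[symmetric] by (rule hull_minimal[rotated])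
      then show ?thesis using n by blast
    qed
    \<comment> \<open>Induction on a set \<open>D\<close> that contains all points other than
      \<open>a\<close> where \<theta> differs from the identity.\<close>
    have supp: "(\<theta>, \<delta> a (\<theta> a)) \<in> \<sigma>"
      if "finite D" "D \<subseteq> A - {a}" "\<theta> \<in> A \<rightarrow>\<^sub>E carrier N" "\<forall>c\<in>A - {a} - D. \<theta> c = \<one>\<^bsub>N\<^esub>" for D \<theta>
      using that
    proof (induction D arbitrary: \<theta>)
      case empty
      then have "\<delta> a (\<theta> a) = \<theta>"
        by (auto simp: \<delta>_def PiE_iff extensional_def intro!: ext)
      then show ?case using right_congruence_refl[OF \<sigma>, of \<theta>] empty by (simp add: maps_monoid_def)
    next
      case (insert b D)
      \<comment> \<open>Resetting the value at \<open>b\<close> to the identity splits off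
        \<open>\<delta> b (\<theta> b)\<close> as a left factor of \<theta>, and \<open>step\<close>
        deletes it.\<close>
      define \<phi> where "\<phi> = \<theta>(b := \<one>\<^bsub>N\<^esub>)"
      have b: "b \<in> A" "b \<noteq> a" using insert.prems by auto
      have \<phi>: "\<phi> \<in> A \<rightarrow>\<^sub>E carrier N" "\<phi> a = \<theta> a"
        using insert.prems b by (auto simp: \<phi>_def PiE_def extensional_def)
      have "(\<phi>, \<delta> a (\<phi> a)) \<in> \<sigma>"
        by (rule insert.IH) (use insert.prems \<phi> in \<open>auto simp: \<phi>_def\<close>)
      moreover have "\<delta> b (\<theta> b) \<otimes>\<^bsub>?P\<^esub> \<phi> = \<theta>"
        using insert.prems b
        by (auto simp: maps_monoid_def \<delta>_def \<phi>_def PiE_iff extensional_def intro!: ext)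
      ultimately show ?case
        using step[OF \<delta>\<sigma>[OF b, of "\<theta> b"] \<phi>(1)] insert.prems b right_congruence_trans[OF \<sigma>]
        by (metis PiE_mem \<phi>(2))
    qed
    fix p assume "p \<in> eval_kernel A N a"
    then obtain \<theta> \<phi> where p: "p = (\<theta>, \<phi>)" "\<theta> \<in> A \<rightarrow>\<^sub>E carrier N" "\<phi> \<in> A \<rightarrow>\<^sub>E carrier N" "\<theta> a = \<phi> a"
      by (auto simp: eval_kernel_def)
    \<comment> \<open>Both maps reach the same normal form because they agree at \<open>a\<close>;
      the finiteness of \<open>A\<close> enters through the choice of \<open>A - {a}\<close> for
      \<open>D\<close>.\<close>
    then have "(\<theta>, \<delta> a (\<theta> a)) \<in> \<sigma>" "(\<phi>, \<delta> a (\<theta> a)) \<in> \<sigma>"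
      using supp[of "A - {a}" \<theta>] supp[of "A - {a}" \<phi>] \<open>finite A\<close> by auto
    then show "p \<in> \<sigma>"
      unfolding p(1) by (metis right_congruence_sym[OF \<sigma>] right_congruence_trans[OF \<sigma>])
  qed
  moreover have "finite K" using \<open>finite A\<close> S(1) by (simp add: K_def)
  moreover have "K \<subseteq> eval_kernel A N a"
    using S(2) \<delta>P \<open>a \<in> A\<close> by (auto simp: K_def eval_kernel_def maps_monoid_def \<delta>_def)
  ultimately show ?thesis
    unfolding eval_kernel_finitely_generated_def by blast
qed

section \<open>Finite presentation of the wreath product\<close>

lemma wreath_mult:
  "(m, \<theta>) \<otimes>\<^bsub>wreath_monoid M N A act\<^esub> (n, \<phi>) =
    (m \<otimes>\<^bsub>M\<^esub> n, \<lambda>a\<in>A. \<theta> a \<otimes>\<^bsub>N\<^esub> \<phi> (act a m))"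
  by (auto simp: wreath_monoid_def maps_monoid_def twist_def intro!: restrict_ext)

lemma carrier_wreath_monoid:
  "carrier (wreath_monoid M N A act) = carrier M \<times> (A \<rightarrow>\<^sub>E carrier N)"
  by (simp add: wreath_monoid_def maps_monoid_def)

text \<open>Every element of the free act on \<open>X \<times> Y\<close> is congruent to one whose
  map is constant. Between such elements, equality of the images in \<open>A \<times> B\<close>
  splits into an equality in \<open>A\<close> and one in \<open>B\<close>, which the lifted
  relations settle separately.\<close>

lemma finitely_presented_wreath_act:
  fixes N :: "('n, 's) monoid_scheme"
  assumes "finitely_presented_act M A actA" "finitely_presented_act N B actB"
    and ev: "\<And>a. a \<in> A \<Longrightarrow> eval_kernel_finitely_generated A N a"
  shows "finitely_presented_act (wreath_monoid M N A actA) (A \<times> B) (wreath_act actA actB)"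
proof -
  interpret M: right_act M A actA using assms(1) by (simp add: finitely_presented_act_def)
  interpret N: right_act N B actB using assms(2) by (simp add: finitely_presented_act_def)
  let ?W = "wreath_monoid M N A actA" and ?P = "maps_monoid A N"
  interpret W: right_act ?W "A \<times> B" "wreath_act actA actB"
    by (rule right_act_wreath_act) unfold_locales
  obtain X :: "nat set" and g R where X: "finite X" "\<And>x. x \<in> X \<Longrightarrow> g x \<in> A"
    "\<And>a. a \<in> A \<Longrightarrow> \<exists>x\<in>X. \<exists>m\<in>carrier M. actA (g x) m = a"
    and R: "finite R" "R \<subseteq> free_act_kernel M actA X g"
    "\<And>\<sigma>. act_congruence M (free_act_carrier M X) (free_act M) \<sigma> \<Longrightarrow> R \<subseteq> \<sigma>
      \<Longrightarrow> free_act_kernel M actA X g \<subseteq> \<sigma>"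
    using assms(1) by (rule finitely_presented_actE) blast
  obtain Y :: "nat set" and h S where Y: "finite Y" "\<And>y. y \<in> Y \<Longrightarrow> h y \<in> B"
    "\<And>b. b \<in> B \<Longrightarrow> \<exists>y\<in>Y. \<exists>n\<in>carrier N. actB (h y) n = b"
    and S: "finite S" "S \<subseteq> free_act_kernel N actB Y h"
    "\<And>\<sigma>. act_congruence N (free_act_carrier N Y) (free_act N) \<sigma> \<Longrightarrow> S \<subseteq> \<sigma>
      \<Longrightarrow> free_act_kernel N actB Y h \<subseteq> \<sigma>"
    using assms(2) by (rule finitely_presented_actE) blast
  obtain K where K: "\<And>a. a \<in> A \<Longrightarrow> finite (K a)" "\<And>a. a \<in> A \<Longrightarrow> K a \<subseteq> eval_kernel A N a"
    "\<And>a \<sigma>. a \<in> A \<Longrightarrow> right_congruence ?P \<sigma> \<Longrightarrow> K a \<subseteq> \<sigma> \<Longrightarrow> eval_kernel A N a \<subseteq> \<sigma>"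
    using ev unfolding eval_kernel_finitely_generated_def by metis
  \<comment> \<open>Constant maps are unchanged by the twist, so \<open>(m, c 1)\<close> and
    \<open>(1, c n)\<close> give commuting copies of \<open>M\<close> and \<open>N\<close> in the
    wreath monoid.\<close>
  define c where "c n = (\<lambda>a\<in>A. n)" for n :: 'n
  define G where "G = (\<lambda>(x, y). (g x, h y))"
  \<comment> \<open>\<open>T1\<close> lifts the relations of \<open>A\<close> at each fixed
    \<open>y\<close>, \<open>T2\<close> those of \<open>B\<close> at each fixed \<open>x\<close>,
    and \<open>T3\<close> the generators of the evaluation kernel at each
    \<open>g x\<close>.\<close>
  define T1 where "T1 = (\<Union>y\<in>Y. (\<lambda>((x, m), (x', m')). (((x, y), (m, c \<one>\<^bsub>N\<^esub>)), ((x', y), (m', c \<one>\<^bsub>N\<^esub>)))) ` R)"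
  define T2 where "T2 = (\<Union>x\<in>X. (\<lambda>((y, n), (y', n')). (((x, y), (\<one>\<^bsub>M\<^esub>, c n)), ((x, y'), (\<one>\<^bsub>M\<^esub>, c n')))) ` S)"
  define T3 where "T3 = (\<Union>x\<in>X. \<Union>y\<in>Y. (\<lambda>(\<theta>, \<phi>). (((x, y), (\<one>\<^bsub>M\<^esub>, \<theta>)), ((x, y), (\<one>\<^bsub>M\<^esub>, \<phi>)))) ` K (g x))"
  let ?Z = "X \<times> Y"
  let ?ker = "free_act_kernel ?W (wreath_act actA actB) ?Z G"
  have cP: "c n \<in> A \<rightarrow>\<^sub>E carrier N" if "n \<in> carrier N" for n
    using that by (auto simp: c_def)
  show ?thesis
  proof (rule W.finitely_presented_act_kernelI[where X = ?Z and R = "T1 \<union> T2 \<union> T3" and g = G])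
    show "finite ?Z" using X(1) Y(1) by simp
    show "finite (T1 \<union> T2 \<union> T3)"
      using X(1,2) Y(1) R(1) S(1) K(1) by (simp add: T1_def T2_def T3_def)
    show "G z \<in> A \<times> B" if "z \<in> ?Z" for z
      using that X(2) Y(2) by (auto simp: G_def)
    show "\<exists>z\<in>?Z. \<exists>w\<in>carrier ?W. wreath_act actA actB (G z) w = p" if p: "p \<in> A \<times> B" for p
    proof -
      obtain x m where x: "x \<in> X" "m \<in> carrier M" "actA (g x) m = fst p"
        using X(3)[of "fst p"] p by auto
      obtain y n where y: "y \<in> Y" "n \<in> carrier N" "actB (h y) n = snd p"
        using Y(3)[of "snd p"] p by auto
      have "wreath_act actA actB (G (x, y)) (m, c n) = p"
        using x y X(2) by (simp add: wreath_act_def G_def c_def)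
      moreover have "(x, y) \<in> ?Z" "(m, c n) \<in> carrier ?W"
        using x y cP by (auto simp: carrier_wreath_monoid)
      ultimately show ?thesis by blast
    qed
    have "T1 \<subseteq> ?ker"
      using R(2) X(2) cP[of "\<one>\<^bsub>N\<^esub>"]
      by (fastforce simp: T1_def free_act_kernel_def carrier_wreath_monoid wreath_act_def G_def c_def)
    moreover have "T2 \<subseteq> ?ker"
      using S(2) X(2) cP
      by (fastforce simp: T2_def free_act_kernel_def carrier_wreath_monoid wreath_act_def G_def c_def)
    moreover have "T3 \<subseteq> ?ker"
      using K(2) X(2)
      by (fastforce simp: T3_def free_act_kernel_def eval_kernel_def carrier_wreath_monoid
          wreath_act_def G_def)
    ultimately show "T1 \<union> T2 \<union> T3 \<subseteq> ?ker" by simp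
  next
    fix \<sigma>
    assume \<sigma>: "act_congruence ?W (free_act_carrier ?W ?Z) (free_act ?W) \<sigma>"
      and T: "T1 \<union> T2 \<union> T3 \<subseteq> \<sigma>"
    have sym: "(q, p) \<in> \<sigma>" if "(p, q) \<in> \<sigma>" for p q
      using \<sigma> that by (auto simp: act_congruence_def equiv_def dest: symD)
    have trans: "(p, r) \<in> \<sigma>" if "(p, q) \<in> \<sigma>" "(q, r) \<in> \<sigma>" for p q r
      using \<sigma> that by (auto simp: act_congruence_def equiv_def dest: transD)
    have mult: "((z, w \<otimes>\<^bsub>?W\<^esub> v), (z', w' \<otimes>\<^bsub>?W\<^esub> v)) \<in> \<sigma>"
      if "((z, w), (z', w')) \<in> \<sigma>" "v \<in> carrier ?W" for z z' w w' v
      using \<sigma> that by (fastforce simp: act_congruence_def free_act_def)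
    have liftA: "(((x, y), (m, c \<one>\<^bsub>N\<^esub>)), ((x', y), (m', c \<one>\<^bsub>N\<^esub>))) \<in> \<sigma>"
      if ker: "((x, m), (x', m')) \<in> free_act_kernel M actA X g" and y: "y \<in> Y" for x m x' m' y
    proof -
      let ?F = "free_act_carrier M X"
      let ?j = "\<lambda>(x, m). ((x, y), (m, c \<one>\<^bsub>N\<^esub>))"
      \<comment> \<open>The preimage of \<sigma> along \<open>?j\<close> is a congruence on the free
        \<open>M\<close>-act that contains \<open>R\<close>, hence the whole kernel for
        \<open>A\<close>. The two lifts that follow use the same argument.\<close>
      let ?\<tau> = "{(p, q) \<in> ?F \<times> ?F. (?j p, ?j q) \<in> \<sigma>}"
      have "act_congruence M ?F (free_act M) ?\<tau>"
        by (rule act_congruence_vimage[OF \<sigma>, where u = "\<lambda>m. (m, c \<one>\<^bsub>N\<^esub>)"])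
          (use y cP in \<open>auto simp: free_act_carrier_def free_act_def carrier_wreath_monoid
            wreath_mult c_def M.act_closed intro!: ext\<close>)
      moreover have "R \<subseteq> ?\<tau>"
      proof
        fix p assume "p \<in> R"
        moreover from this have "p \<in> ?F \<times> ?F"
          using R(2) by (auto simp: free_act_kernel_def free_act_carrier_def)
        moreover from \<open>p \<in> R\<close> have "map_prod ?j ?j p \<in> T1"
          using y unfolding T1_def by (intro UN_I[of y] image_eqI[of _ _ p]) (auto simp: map_prod_def split_beta)
        ultimately show "p \<in> ?\<tau>" using T by (cases p) auto
      qed
      ultimately have "((x, m), (x', m')) \<in> ?\<tau>"
        using R(3) ker by (meson subsetD)
      then show ?thesis by simp
    qed
    have liftB: "(((x, y), (\<one>\<^bsub>M\<^esub>, c n)), ((x, y'), (\<one>\<^bsub>M\<^esub>, c n'))) \<in> \<sigma>"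
      if ker: "((y, n), (y', n')) \<in> free_act_kernel N actB Y h" and x: "x \<in> X" for y n y' n' x
    proof -
      let ?F = "free_act_carrier N Y"
      let ?j = "\<lambda>(y, n). ((x, y), (\<one>\<^bsub>M\<^esub>, c n))"
      let ?\<tau> = "{(p, q) \<in> ?F \<times> ?F. (?j p, ?j q) \<in> \<sigma>}"
      have "act_congruence N ?F (free_act N) ?\<tau>"
        by (rule act_congruence_vimage[OF \<sigma>, where u = "\<lambda>n. (\<one>\<^bsub>M\<^esub>, c n)"])
          (use x cP in \<open>auto simp: free_act_carrier_def free_act_def carrier_wreath_monoid
            wreath_mult c_def M.act_one intro!: ext\<close>)
      moreover have "S \<subseteq> ?\<tau>"
      proof
        fix p assume "p \<in> S"
        moreover from this have "p \<in> ?F \<times> ?F"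
          using S(2) by (auto simp: free_act_kernel_def free_act_carrier_def)
        moreover from \<open>p \<in> S\<close> have "map_prod ?j ?j p \<in> T2"
          using x unfolding T2_def by (intro UN_I[of x] image_eqI[of _ _ p]) (auto simp: map_prod_def split_beta)
        ultimately show "p \<in> ?\<tau>" using T by (cases p) auto
      qed
      ultimately have "((y, n), (y', n')) \<in> ?\<tau>"
        using S(3) ker by (meson subsetD)
      then show ?thesis by simp
    qed
    have liftP: "(((x, y), (\<one>\<^bsub>M\<^esub>, \<theta>)), ((x, y), (\<one>\<^bsub>M\<^esub>, \<phi>))) \<in> \<sigma>"
      if ker: "(\<theta>, \<phi>) \<in> eval_kernel A N (g x)" and x: "x \<in> X" and y: "y \<in> Y" for x y \<theta> \<phi>
    proof -
      let ?j = "\<lambda>\<theta>. ((x, y), (\<one>\<^bsub>M\<^esub>, \<theta>))"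
      let ?\<tau> = "{(p, q) \<in> carrier ?P \<times> carrier ?P. (?j p, ?j q) \<in> \<sigma>}"
      have "right_congruence ?P ?\<tau>"
        unfolding right_congruence_def
        by (rule act_congruence_vimage[OF \<sigma>, where u = "\<lambda>\<theta>. (\<one>\<^bsub>M\<^esub>, \<theta>)"])
          (use x y in \<open>auto simp: free_act_carrier_def free_act_def carrier_wreath_monoid
            wreath_mult maps_monoid_def M.act_one PiE_iff intro!: restrict_ext\<close>)
      moreover have "K (g x) \<subseteq> ?\<tau>"
      proof
        fix p assume "p \<in> K (g x)"
        moreover from this have "p \<in> carrier ?P \<times> carrier ?P"
          using K(2) X(2)[OF x] by (fastforce simp: eval_kernel_def maps_monoid_def)
        moreover from \<open>p \<in> K (g x)\<close> have "map_prod ?j ?j p \<in> T3"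
          using x y unfolding T3_def
          by (intro UN_I[of x] UN_I[of y] image_eqI[of _ _ p]) (auto simp: map_prod_def split_beta)
        ultimately show "p \<in> ?\<tau>" using T by (cases p) auto
      qed
      ultimately have "(\<theta>, \<phi>) \<in> ?\<tau>"
        using K(3)[OF X(2)[OF x]] ker by (meson subsetD)
      then show ?thesis by simp
    qed
    \<comment> \<open>These two factorisations let a relation be multiplied on the right so that one
      component changes while the other is kept.\<close>
    have mult1: "(\<one>\<^bsub>M\<^esub>, \<theta>) \<otimes>\<^bsub>?W\<^esub> (m, c \<one>\<^bsub>N\<^esub>) = (m, \<theta>)"
      if "\<theta> \<in> A \<rightarrow>\<^sub>E carrier N" "m \<in> carrier M" for \<theta> m
      using that by (auto simp: wreath_mult c_def M.act_one PiE_iff extensional_def intro!: ext)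
    have mult2: "(m, c \<one>\<^bsub>N\<^esub>) \<otimes>\<^bsub>?W\<^esub> (\<one>\<^bsub>M\<^esub>, c n) = (m, c n)"
      if "n \<in> carrier N" "m \<in> carrier M" for n m
      using that by (auto simp: wreath_mult c_def M.act_closed intro!: ext)
    \<comment> \<open>The constant is the value at \<open>g x\<close>, not at its image under
      \<open>m\<close>, because the wreath action evaluates the map before moving the point. The
      relation is obtained with first component \<open>1\<close> and then multiplied by
      \<open>(m, c 1)\<close>.\<close>
    have reduce: "(((x, y), (m, \<theta>)), ((x, y), (m, c (\<theta> (g x))))) \<in> \<sigma>"
      if x: "x \<in> X" and y: "y \<in> Y" and m: "m \<in> carrier M" and \<theta>: "\<theta> \<in> A \<rightarrow>\<^sub>E carrier N" for x y m \<theta>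
    proof -
      have n: "\<theta> (g x) \<in> carrier N" using \<theta> X(2)[OF x] by (rule PiE_mem)
      then have "(\<theta>, c (\<theta> (g x))) \<in> eval_kernel A N (g x)"
        using \<theta> cP X(2)[OF x] by (simp add: eval_kernel_def) (simp add: c_def)
      then have "(((x, y), (\<one>\<^bsub>M\<^esub>, \<theta>)), ((x, y), (\<one>\<^bsub>M\<^esub>, c (\<theta> (g x))))) \<in> \<sigma>"
        using x y by (rule liftP)
      from mult[OF this, of "(m, c \<one>\<^bsub>N\<^esub>)"] show ?thesis
        using m \<theta> n cP by (simp add: mult1 carrier_wreath_monoid)
    qed
    \<comment> \<open>First the \<open>A\<close>-part changes, with \<open>(1, c n)\<close>
      multiplied on; then the \<open>B\<close>-part changes, with \<open>(m', c 1)\<close>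
      multiplied on. The intermediate element is \<open>((x', y), (m', c n))\<close>.\<close>
    have move: "(((x, y), (m, c n)), ((x', y'), (m', c n'))) \<in> \<sigma>"
      if A: "((x, m), (x', m')) \<in> free_act_kernel M actA X g"
        and B: "((y, n), (y', n')) \<in> free_act_kernel N actB Y h" for x m x' m' y n y' n'
    proof -
      have mem: "x' \<in> X" "y \<in> Y" "m \<in> carrier M" "m' \<in> carrier M" "n \<in> carrier N" "n' \<in> carrier N"
        using A B by (auto simp: free_act_kernel_def)
      have "(((x, y), (m, c n)), ((x', y), (m', c n))) \<in> \<sigma>"
        using mult[OF liftA[OF A mem(2)], of "(\<one>\<^bsub>M\<^esub>, c n)"] mem cP
        by (simp add: mult2 carrier_wreath_monoid)
      moreover have "(((x', y), (m', c n)), ((x', y'), (m', c n'))) \<in> \<sigma>"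
        using mult[OF liftB[OF B mem(1)], of "(m', c \<one>\<^bsub>N\<^esub>)"] mem cP
        by (simp add: mult1 carrier_wreath_monoid)
      ultimately show ?thesis by (rule trans)
    qed
    show "?ker \<subseteq> \<sigma>"
    proof
      fix p assume p: "p \<in> ?ker"
      obtain x y m \<theta> x' y' m' \<theta>' where eq: "p = (((x, y), (m, \<theta>)), ((x', y'), (m', \<theta>')))"
        by (metis surj_pair)
      have mem: "x \<in> X" "y \<in> Y" "m \<in> carrier M" "\<theta> \<in> A \<rightarrow>\<^sub>E carrier N"
        "x' \<in> X" "y' \<in> Y" "m' \<in> carrier M" "\<theta>' \<in> A \<rightarrow>\<^sub>E carrier N"
        and A: "actA (g x) m = actA (g x') m'"
        and B: "actB (h y) (\<theta> (g x)) = actB (h y') (\<theta>' (g x'))"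
        using p unfolding eq
        by (auto simp: free_act_kernel_def carrier_wreath_monoid wreath_act_def G_def)
      \<comment> \<open>The two normal forms are joined here; \<open>reduce\<close> at both ends
        then gives the pair itself.\<close>
      have "(((x, y), (m, c (\<theta> (g x)))), ((x', y'), (m', c (\<theta>' (g x'))))) \<in> \<sigma>"
        using mem A B X(2) by (intro move) (auto simp: free_act_kernel_def intro: PiE_mem)
      then show "p \<in> \<sigma>"
        unfolding eq using reduce[OF mem(1-4)] reduce[OF mem(5-8)] trans sym by meson
    qed
  qed
qed

theorem corollary5p6:
  fixes M :: "('m, 'r) monoid_scheme" and N :: "('n, 's) monoid_scheme"
    and A :: "'a set" and actA :: "'a \<Rightarrow> 'm \<Rightarrow> 'a"
    and B :: "'b set" and actB :: "'b \<Rightarrow> 'n \<Rightarrow> 'b"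
  assumes "monoid M" and "monoid N"
    and "right_act M A actA" and "finitely_presented_act M A actA"
    and "right_act N B actB" and "finitely_presented_act N B actB"
    and "(\<exists>a. A = {a})
       \<or> carrier N = {\<one>\<^bsub>N\<^esub>}
       \<or> (\<exists>z\<in>carrier N. \<forall>n\<in>carrier N. z \<otimes>\<^bsub>N\<^esub> n = z)
       \<or> (finite A \<and> finitely_generated_monoid N)"
  shows "finitely_presented_act (wreath_monoid M N A actA) (A \<times> B) (wreath_act actA actB)"
  using assms(4,6)
proof (rule finitely_presented_wreath_act)
  fix a assume a: "a \<in> A"
  from assms(7) consider "A = {a}" | "carrier N = {\<one>\<^bsub>N\<^esub>}"
    | z where "z \<in> carrier N" "\<And>n. n \<in> carrier N \<Longrightarrow> z \<otimes>\<^bsub>N\<^esub> n = z"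
    | "finite A" "finitely_generated_monoid N"
    using a by blast
  then show "eval_kernel_finitely_generated A N a"
  proof cases
    \<comment> \<open>A map on a one-point set is determined by its value at that point.\<close>
    case 1
    show ?thesis
      by (rule eval_kernel_finitely_generated_trivial)
        (auto simp: eval_kernel_def 1 intro: PiE_ext)
  next
    \<comment> \<open>There is only one map into a trivial monoid.\<close>
    case 2
    show ?thesis
      by (rule eval_kernel_finitely_generated_trivial)
        (auto simp: eval_kernel_def 2 intro!: PiE_ext dest: PiE_mem)
  next
    case 3
    with \<open>monoid N\<close> a show ?thesis by (intro eval_kernel_finitely_generated_left_zero)
  next
    case 4
    with \<open>monoid N\<close> a show ?thesis by (intro eval_kernel_finitely_generated_finite)
  qed
qed

end
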